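(* Let $\beta\in\mathbb R^p$, $X\in\mathbb R^{n\times p}$, $\varepsilon\in\mathbb R^n$, $\sigma>0$, let $\Sigma\in\mathbb R^{p\times p}$ be symmetric positive definite, let $y=X\beta+\varepsilon$, and let $g:\mathbb R^p\to\mathbb R$ be convex. Let $\hat\beta$ be a minimizer of $b\mapsto\|y-Xb\|^2/(2n)+g(b)$ and $h=\hat\beta-\beta$. Let $\beta^*=\arg\min_{b\in\mathbb R^p}\{\|\Sigma^{1/2}(\beta-b)\|^2/2+g(b)\}$, $h^*=\beta^*-\beta$, $R_*=\sigma^2+\|\Sigma^{1/2}h^*\|^2$. Suppose that for some $\mu\in[0,1/2]$ the penalty satisfies $$u^\top\{(\partial g)(u+\beta^* )-(\partial g)(\beta^* )\}\ge\mu\|\Sigma^{1/2}u\|^2\qquad\forall u\in\mathbb R^p$$ (for all choices of subgradients). Let $$F_+=\max\Big\{\frac{\|X h^*\|^2}{n\|\Sigma^{1/2}h^*\|^2},\ \frac{\|\varepsilon\|^2}{\sigma^2n},\ \frac{\|\varepsilon-Xh^*\|^2}{nR_*},\ 1\Big\}$$ and let $F$ be any real number such that $F/2\ge1$ and either $\|\Sigma^{1/2}h\|^2\le(F/2)\,\|Xh\|^2/n$ or $F/2=\mu^{-1}$. Then, with $\bar\sigma^2=F_+\sigma^2+(F_+-1)\|\Sigma^{1/2}h^*\|^2=(F_+-1)R_*+\sigma^2$, $$\|\Sigma^{1/2}h\|^2\le F^2\max\big(\bar\sigma^2,\|\Sigma^{1/2}h^*\|^2\big)\le F_+F^2R_*,$$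 $$\|Xh\|^2/n\le\max\big\{2F\bar\sigma^2,\ \bar\sigma^2+F^2\|\Sigma^{1/2}h^*\|^2\big\}\le F_+F^2R_*.$$
   Context: $\partial g(b)$ denotes the subdifferential of $g$ at $b$; $\|\cdot\|$ is the Euclidean norm. If $h^*=0$, the first term in the maximum defining $F_+$ is omitted. The option $F/2=\mu^{-1}$ presupposes $\mu>0$. *)

theory Defs
  imports "HOL-Analysis.Analysis"
begin

definition subdifferential :: "('a::real_inner \<Rightarrow> real) \<Rightarrow> 'a \<Rightarrow> 'a set" where
  "subdifferential g b = {v. \<forall>x. g x \<ge> g b + v \<bullet> (x - b)}"

definition sym_pos_def :: "real ^ 'p ^ 'p \<Rightarrow> bool" where
  "sym_pos_def A \<longleftrightarrow> transpose A = A \<and> (\<forall>x. x \<noteq> 0 \<longrightarrow> x \<bullet> (A *v x) > 0)"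

definition sym_pos_semidef :: "real ^ 'p ^ 'p \<Rightarrow> bool" where
  "sym_pos_semidef A \<longleftrightarrow> transpose A = A \<and> (\<forall>x. x \<bullet> (A *v x) \<ge> 0)"

text \<open>The principal square root; it exists and is unique when A is symmetric positive
  semidefinite, and the definition is only meaningful for such A.\<close>

definition matrix_sqrt :: "real ^ 'p ^ 'p \<Rightarrow> real ^ 'p ^ 'p" where
  "matrix_sqrt A = (THE S. sym_pos_semidef S \<and> S ** S = A)"

end

theory Submission
  imports Defs
begin

text \<open>
  Write \<open>S\<close> for the square root of \<open>\<Sigma>\<close>, \<open>p = S h\<close>, \<open>q = S h\<^sup>*\<close> and \<open>t = \<parallel>X h\<parallel>\<^sup>2 / n\<close>. Both
  \<open>\<beta>hat\<close> and \<open>\<beta>\<^sup>*\<close> minimise a least squares loss plus the convex penalty \<open>g\<close>, so each provides a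
  subgradient of \<open>g\<close> that is the negative gradient of its loss
  (\<open>subgradient_at_penalised_least_squares_minimiser\<close>). The penalty condition, applied to these two
  subgradients in the direction \<open>u = h - h\<^sup>*\<close>, says
  \<open>\<mu> \<parallel>p - q\<parallel>\<^sup>2 \<le> (X h - X h\<^sup>*) \<bullet> (\<epsilon> - X h) / n + (p - q) \<bullet> q\<close>.

  Completing squares bounds both inner products by squared norms, and the definition of \<open>F\<^sub>+\<close> bounds
  \<open>(\<parallel>\<epsilon>\<parallel>\<^sup>2 + \<parallel>X h\<^sup>*\<parallel>\<^sup>2) / n\<close> by \<open>F\<^sub>+ R\<^sub>*\<close>, which equals the sum of \<open>\<parallel>q\<parallel>\<^sup>2\<close> and the effective
  noise level \<open>B\<close> (the bar-sigma squared of the statement). The outcome is the single inequality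
  \<open>t + (1 + 2 \<mu>) \<parallel>p - q\<parallel>\<^sup>2 \<le> B + \<parallel>p\<parallel>\<^sup>2\<close>
  of \<open>energy_inequality\<close>. By the triangle inequality it may be read as a quadratic inequality between
  the real numbers \<open>\<parallel>p\<parallel>\<close>, \<open>\<parallel>q\<parallel>\<close> and \<open>t\<close>, and the remainder is elementary: each alternative for \<open>F\<close>
  gives \<open>\<parallel>p\<parallel> \<le> F m\<close> where \<open>m\<^sup>2\<close> is the larger of \<open>B\<close> and \<open>\<parallel>q\<parallel>\<^sup>2\<close>
  (\<open>estimation_error_from_restricted_eigenvalue\<close>, \<open>estimation_error_from_strong_monotonicity\<close>),
  and inserting this bound back bounds \<open>t\<close> (\<open>prediction_error_from_estimation_error\<close>).

  Bounding \<open>\<parallel>X h\<^sup>*\<parallel>\<^sup>2 / n\<close> by \<open>F\<^sub>+ \<parallel>q\<parallel>\<^sup>2\<close> divides by \<open>\<parallel>q\<parallel>\<^sup>2\<close>, so one has to know that \<open>S h\<^sup>*\<close> vanishes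
  only if \<open>h\<^sup>*\<close> does. Since \<open>S\<close> is given by a definite description, this rests on the existence and
  uniqueness of the positive semidefinite square root, both of which are derived from the spectral
  theorem for symmetric matrices.
\<close>

section \<open>Square roots of positive definite matrices\<close>

text \<open>A nonnegative quadratic form with value zero at \<open>x\<close> is minimal there, so its gradient
  vanishes at \<open>x\<close>. Moving from \<open>x\<close> a short way against the gradient \<open>f x\<close> would otherwise make
  the form negative.\<close>

lemma psd_form_zero_imp_zero:
  fixes f :: "'a::real_inner \<Rightarrow> 'a"
  assumes lin: "linear f" and V: "subspace V" and inv: "\<And>v. v \<in> V \<Longrightarrow> f v \<in> V"
    and sa: "\<And>u v. u \<in> V \<Longrightarrow> v \<in> V \<Longrightarrow> f u \<bullet> v = u \<bullet> f v"
    and psd: "\<And>v. v \<in> V \<Longrightarrow> 0 \<le> v \<bullet> f v"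
    and x: "x \<in> V" "x \<bullet> f x = 0"
  shows "f x = 0"
proof (rule ccontr)
  assume "f x \<noteq> 0"
  define N P where "N = f x \<bullet> f x" and "P = f x \<bullet> f (f x)"
  have N: "N > 0" using \<open>f x \<noteq> 0\<close> by (simp add: N_def)
  have P: "P \<ge> 0" using psd inv x by (simp add: P_def)
  \<comment> \<open>The minimiser \<open>N / P\<close> of \<open>t\<^sup>2 P - 2 t N\<close>, with 1 added to \<open>P\<close> to cover the case \<open>P = 0\<close>.\<close>
  define t where "t = N / (P + 1)"
  have t: "t > 0" using N P by (simp add: t_def)
  have "x - t *\<^sub>R f x \<in> V" using V x inv by (simp add: subspace_diff subspace_scale)
  then have "0 \<le> (x - t *\<^sub>R f x) \<bullet> f (x - t *\<^sub>R f x)" by (rule psd)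
  also have "\<dots> = t * (t * P - 2 * N)"
    using x sa[of "x" "f x"] inv[of x]
    by (simp add: linear_diff[OF lin] linear_scale[OF lin] inner_diff_left inner_diff_right
        N_def P_def algebra_simps)
  finally have "2 * N \<le> t * P" using t by (simp add: zero_le_mult_iff)
  moreover have "t * P \<le> N"
    using N P by (simp add: t_def field_simps)
  ultimately show False using N by simp
qed

text \<open>The spectral theorem, by induction on the dimension. A maximiser \<open>x\<close> of the Rayleigh quotient
  on the unit sphere of \<open>V\<close>, with maximum \<open>m\<close>, is an eigenvector: the form of \<open>m I - f\<close> is
  nonnegative on \<open>V\<close> and vanishes at \<open>x\<close>. The orthogonal complement of \<open>x\<close> in \<open>V\<close> is again
  invariant. Quantifying over invariant subspaces, instead of the whole space, is what
  makes the induction possible without changing the type.\<close>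

lemma selfadjoint_eigenbasis:
  fixes f :: "'a::euclidean_space \<Rightarrow> 'a"
  assumes lin: "linear f" and sa: "\<And>u v. f u \<bullet> v = u \<bullet> f v"
    and "subspace V" and "\<And>v. v \<in> V \<Longrightarrow> f v \<in> V"
  shows "\<exists>B. finite B \<and> B \<subseteq> V \<and> (\<forall>b\<in>B. \<forall>c\<in>B. b \<bullet> c = (if b = c then 1 else 0))
    \<and> (\<forall>b\<in>B. f b = (b \<bullet> f b) *\<^sub>R b) \<and> (\<forall>v\<in>V. v = (\<Sum>b\<in>B. (v \<bullet> b) *\<^sub>R b))"
  using assms(3,4)
proof (induction "dim V" arbitrary: V rule: less_induct)
  case less
  note V = \<open>subspace V\<close> and inv = less.prems(2)
  show ?case
  proof (cases "V = {0}")
    case True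
    then show ?thesis by (intro exI[of _ "{}"]) auto
  next
    case False
    then obtain w where w: "w \<in> V" "w \<noteq> 0" using subspace_0[OF V] by blast
    have "compact (V \<inter> sphere 0 1)"
      using closed_subspace[OF V] by (simp add: closed_Int_compact)
    moreover have "w /\<^sub>R norm w \<in> V \<inter> sphere 0 1"
      using w V by (simp add: subspace_scale)
    moreover have "continuous_on (V \<inter> sphere 0 1) (\<lambda>v. v \<bullet> f v)"
      by (intro continuous_intros linear_continuous_on) (simp add: lin linear_conv_bounded_linear[symmetric])
    ultimately have "\<exists>x\<in>V \<inter> sphere 0 1. \<forall>v\<in>V \<inter> sphere 0 1. v \<bullet> f v \<le> x \<bullet> f x"
      by (intro continuous_attains_sup) blast+
    then obtain x where x: "x \<in> V" "norm x = 1"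
      and max: "\<And>v. v \<in> V \<Longrightarrow> norm v = 1 \<Longrightarrow> v \<bullet> f v \<le> x \<bullet> f x"
      by auto
    define m where "m = x \<bullet> f x"
    have bound: "v \<bullet> f v \<le> m * (v \<bullet> v)" if "v \<in> V" for v
    proof (cases "v = 0")
      case False
      have "(v /\<^sub>R norm v) \<bullet> f (v /\<^sub>R norm v) \<le> m"
        unfolding m_def using False that V by (intro max) (simp_all add: subspace_scale)
      then show ?thesis
        using False by (simp add: linear_scale[OF lin] field_simps dot_square_norm power2_eq_square)
    qed simp
    have "m *\<^sub>R x - f x = 0"
    proof (rule psd_form_zero_imp_zero[of "\<lambda>v. m *\<^sub>R v - f v" V])
      show "linear (\<lambda>v. m *\<^sub>R v - f v)"
        by (intro linear_compose_sub lin linear_scale_self)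
      show "x \<bullet> (m *\<^sub>R x - f x) = 0"
        using x by (simp add: inner_diff_right m_def dot_square_norm)
    qed (use V x inv sa bound in \<open>auto simp: subspace_diff subspace_scale inner_diff_left inner_diff_right\<close>)
    then have eig: "f x = m *\<^sub>R x" by simp
    define W where "W = V \<inter> {v. orthogonal x v}"
    have W: "subspace W"
      unfolding W_def using V by (intro subspace_inter subspace_orthogonal_to_vector)
    have invW: "f v \<in> W" if "v \<in> W" for v
      using that inv sa[of x v] by (auto simp: W_def orthogonal_def eig)
    have "x \<notin> W" using x by (simp add: W_def orthogonal_def dot_square_norm)
    then have "W \<subset> V" using x by (auto simp: W_def)
    then have "dim W < dim V"
      using V W by (intro dim_psubset) (metis span_eq_iff)
    from less.hyps[OF this W invW] obtain B where B: "finite B" "B \<subseteq> W"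
      "\<And>b c. b \<in> B \<Longrightarrow> c \<in> B \<Longrightarrow> b \<bullet> c = (if b = c then 1 else 0)"
      "\<And>b. b \<in> B \<Longrightarrow> f b = (b \<bullet> f b) *\<^sub>R b" "\<And>v. v \<in> W \<Longrightarrow> v = (\<Sum>b\<in>B. (v \<bullet> b) *\<^sub>R b)"
      by metis
    have xB: "x \<bullet> b = 0" "b \<bullet> x = 0" if "b \<in> B" for b
      using that B(2) by (auto simp: W_def orthogonal_def inner_commute)
    have xx: "x \<bullet> x = 1" using x by (simp add: dot_square_norm)
    then have "x \<notin> B" using xB by force
    show ?thesis
    proof (intro exI[of _ "insert x B"] conjI ballI)
      fix v assume "v \<in> V"
      define r where "r = v - (v \<bullet> x) *\<^sub>R x"
      have "r \<in> W"
        using \<open>v \<in> V\<close> x V xx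
        by (simp add: r_def W_def orthogonal_def subspace_diff subspace_scale inner_diff_right inner_commute)
      then have "r = (\<Sum>b\<in>B. (r \<bullet> b) *\<^sub>R b)" by (rule B(5))
      also have "\<dots> = (\<Sum>b\<in>B. (v \<bullet> b) *\<^sub>R b)"
        by (intro sum.cong refl) (simp add: r_def inner_diff_left xB)
      finally show "v = (\<Sum>b\<in>insert x B. (v \<bullet> b) *\<^sub>R b)"
        using \<open>x \<notin> B\<close> B(1) by (simp add: r_def algebra_simps)
    next
      fix b assume "b \<in> insert x B"
      then show "f b = (b \<bullet> f b) *\<^sub>R b" using eig m_def B(4) by auto
    next
      fix b c assume "b \<in> insert x B" "c \<in> insert x B"
      then show "b \<bullet> c = (if b = c then 1 else 0)" using B(3) xB xx \<open>x \<notin> B\<close> by auto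
    qed (use B x in \<open>auto simp: W_def\<close>)
  qed
qed

lemma symmetric_matrix_inner:
  fixes A :: "real ^ 'p ^ 'p"
  assumes "transpose A = A"
  shows "(A *v u) \<bullet> v = u \<bullet> (A *v v)"
  using dot_lmul_matrix[of u A v] transpose_matrix_vector[of A u] assms by simp

lemma symmetric_matrixI:
  fixes A :: "real ^ 'p ^ 'p"
  assumes "\<And>u v. (A *v u) \<bullet> v = u \<bullet> (A *v v)"
  shows "transpose A = A"
proof -
  have "u \<bullet> (transpose A *v v) = u \<bullet> (A *v v)" for u v
    using assms[of v u] dot_lmul_matrix[of v A u] inner_commute[of u "A *v v"]
      inner_commute[of u "v v* A"] by simp
  then have "transpose A *v v = A *v v" for v
    using vector_eq_ldot by blast
  then show ?thesis unfolding matrix_eq by blast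
qed

lemma symmetric_matrix_eigenbasis:
  fixes A :: "real ^ 'p ^ 'p"
  assumes "transpose A = A"
  obtains B where "finite B" "\<And>b c. b \<in> B \<Longrightarrow> c \<in> B \<Longrightarrow> b \<bullet> c = (if b = c then 1 else 0)"
    "\<And>b. b \<in> B \<Longrightarrow> A *v b = (b \<bullet> (A *v b)) *\<^sub>R b" "\<And>v. v = (\<Sum>b\<in>B. (v \<bullet> b) *\<^sub>R b)"
proof -
  have "\<exists>B. finite B \<and> B \<subseteq> UNIV \<and> (\<forall>b\<in>B. \<forall>c\<in>B. b \<bullet> c = (if b = c then 1 else 0))
    \<and> (\<forall>b\<in>B. A *v b = (b \<bullet> (A *v b)) *\<^sub>R b) \<and> (\<forall>v\<in>UNIV. v = (\<Sum>b\<in>B. (v \<bullet> b) *\<^sub>R b))"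
    by (rule selfadjoint_eigenbasis) (auto simp: symmetric_matrix_inner[OF assms])
  with that show thesis by auto
qed

text \<open>The square root keeps the eigenvectors and takes square roots of the eigenvalues.\<close>

lemma sym_pos_def_sqrt_exists:
  fixes A :: "real ^ 'p ^ 'p"
  assumes A: "sym_pos_def A"
  shows "\<exists>S. sym_pos_semidef S \<and> S ** S = A"
proof -
  have sym: "transpose A = A" and pd: "\<And>x. x \<noteq> 0 \<Longrightarrow> x \<bullet> (A *v x) > 0"
    using A by (auto simp: sym_pos_def_def)
  obtain B where B: "finite B" "\<And>b c. b \<in> B \<Longrightarrow> c \<in> B \<Longrightarrow> b \<bullet> c = (if b = c then 1 else 0)"
      "\<And>b. b \<in> B \<Longrightarrow> A *v b = (b \<bullet> (A *v b)) *\<^sub>R b" "\<And>v. v = (\<Sum>b\<in>B. (v \<bullet> b) *\<^sub>R b)"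
    by (rule symmetric_matrix_eigenbasis[OF sym]) (rule that)
  define l where "l b = b \<bullet> (A *v b)" for b
  have l: "l b \<ge> 0" if "b \<in> B" for b
    using pd[of b] by (cases "b = 0") (auto simp: l_def)
  define f where "f v = (\<Sum>b\<in>B. (sqrt (l b) * (v \<bullet> b)) *\<^sub>R b)" for v
  have lin: "linear f"
    by (rule linearI)
      (simp_all add: f_def inner_add_left algebra_simps sum.distrib scaleR_sum_right)
  define S where "S = matrix f"
  have S: "S *v v = f v" for v by (simp add: S_def matrix_vector_mul(2)[OF lin])
  have fb: "f b = sqrt (l b) *\<^sub>R b" if "b \<in> B" for b
  proof -
    have "f b = (\<Sum>c\<in>B. if b = c then sqrt (l b) *\<^sub>R b else 0)"
      unfolding f_def by (rule sum.cong) (auto simp: B(2) that)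
    then show ?thesis using B(1) that by simp
  qed
  have ff: "f (f v) = A *v v" for v
  proof -
    have "f (f v) = (\<Sum>b\<in>B. (sqrt (l b) * (v \<bullet> b)) *\<^sub>R f b)"
      by (subst (2) f_def) (simp add: linear_sum[OF lin] linear_scale[OF lin])
    also have "\<dots> = (\<Sum>b\<in>B. (v \<bullet> b) *\<^sub>R (A *v b))"
    proof (rule sum.cong[OF refl])
      fix b assume b: "b \<in> B"
      have "A *v b = l b *\<^sub>R b" using B(3)[OF b] by (simp add: l_def)
      then show "(sqrt (l b) * (v \<bullet> b)) *\<^sub>R f b = (v \<bullet> b) *\<^sub>R (A *v b)"
        using l[OF b] by (simp add: fb[OF b] algebra_simps)
    qed
    also have "\<dots> = A *v (\<Sum>b\<in>B. (v \<bullet> b) *\<^sub>R b)"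
      by (simp add: linear_sum[OF matrix_vector_mul_linear] linear_scale[OF matrix_vector_mul_linear])
    finally show ?thesis by (simp flip: B(4))
  qed
  have "sym_pos_semidef S"
    unfolding sym_pos_semidef_def
  proof (intro conjI allI symmetric_matrixI)
    show "(S *v u) \<bullet> v = u \<bullet> (S *v v)" for u v
      by (simp add: S f_def inner_sum_left inner_sum_right inner_commute mult_ac)
    have "x \<bullet> (S *v x) = (\<Sum>b\<in>B. sqrt (l b) * (x \<bullet> b)\<^sup>2)" for x
      by (simp add: S f_def inner_sum_right power2_eq_square mult.assoc)
    then show "0 \<le> x \<bullet> (S *v x)" for x
      using l by (simp add: sum_nonneg)
  qed
  moreover have "S ** S = A"
    by (simp add: matrix_eq S ff matrix_vector_mul_assoc[symmetric])
  ultimately show ?thesis by blast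
qed

text \<open>For a unit eigenvector \<open>b\<close> of \<open>D = S - T\<close> with eigenvalue \<open>c\<close>,
  \<open>c (b \<bullet> S b + b \<bullet> T b) = (S b - T b) \<bullet> (S b + T b) = \<parallel>S b\<parallel>\<^sup>2 - \<parallel>T b\<parallel>\<^sup>2 = b \<bullet> A b - b \<bullet> A b = 0\<close>.
  The factor in parentheses is positive because \<open>S\<close> is nonsingular, so all eigenvalues of \<open>D\<close>
  are zero.\<close>

lemma sym_pos_def_sqrt_unique:
  fixes A :: "real ^ 'p ^ 'p"
  assumes A: "sym_pos_def A"
    and S: "sym_pos_semidef S" "S ** S = A" and T: "sym_pos_semidef T" "T ** T = A"
  shows "S = T"
proof -
  have symS: "transpose S = S" "\<And>x. x \<bullet> (S *v x) \<ge> 0"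
   and symT: "transpose T = T" "\<And>x. x \<bullet> (T *v x) \<ge> 0"
    using S T by (auto simp: sym_pos_semidef_def)
  let ?D = "S - T"
  have symD: "transpose ?D = ?D"
    by (rule symmetric_matrixI)
      (simp add: matrix_vector_mult_diff_rdistrib inner_diff_left inner_diff_right
        symmetric_matrix_inner[OF symS(1)] symmetric_matrix_inner[OF symT(1)])
  obtain B where B: "\<And>b c. b \<in> B \<Longrightarrow> c \<in> B \<Longrightarrow> b \<bullet> c = (if b = c then 1 else 0)"
      "\<And>b. b \<in> B \<Longrightarrow> ?D *v b = (b \<bullet> (?D *v b)) *\<^sub>R b" "\<And>v. v = (\<Sum>b\<in>B. (v \<bullet> b) *\<^sub>R b)"
    by (rule symmetric_matrix_eigenbasis[OF symD]) (rule that)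
  have Db: "?D *v b = 0" if b: "b \<in> B" for b
  proof -
    define c where "c = b \<bullet> (?D *v b)"
    have b1: "b \<bullet> b = 1" using B(1)[OF b b] by simp
    have Db: "?D *v b = c *\<^sub>R b" unfolding c_def by (rule B(2)[OF b])
    then have Sb: "S *v b - T *v b = c *\<^sub>R b" by (simp only: matrix_vector_mult_diff_rdistrib)
    have "A *v b = S *v (S *v b)" "A *v b = T *v (T *v b)"
      using S(2) T(2) by (simp_all add: matrix_vector_mul_assoc)
    then have eq: "(S *v b) \<bullet> (S *v b) = (T *v b) \<bullet> (T *v b)"
      using symmetric_matrix_inner[OF symS(1), of b "S *v b"]
        symmetric_matrix_inner[OF symT(1), of b "T *v b"] by simp
    have "c * (b \<bullet> (S *v b) + b \<bullet> (T *v b)) = (S *v b - T *v b) \<bullet> (S *v b + T *v b)"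
      unfolding Sb by (simp add: inner_add_right distrib_left)
    also have "\<dots> = 0" using eq by (simp add: algebra_simps inner_commute)
    finally have "c = 0 \<or> b \<bullet> (S *v b) = 0"
      using symS(2)[of b] symT(2)[of b] by auto
    moreover have "b \<bullet> (S *v b) \<noteq> 0"
    proof
      assume "b \<bullet> (S *v b) = 0"
      then have "S *v b = 0"
        by (intro psd_form_zero_imp_zero[of "(*v) S" UNIV])
          (auto simp: symS symmetric_matrix_inner[OF symS(1)])
      then have "A *v b = 0" using \<open>A *v b = S *v (S *v b)\<close> by simp
      moreover have "b \<noteq> 0" using b1 by auto
      then have "b \<bullet> (A *v b) > 0" using A by (simp add: sym_pos_def_def)
      ultimately show False by simp
    qed
    ultimately have "c = 0" by blast
    then show ?thesis using Db by simp
  qed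
  have "?D *v v = 0" for v
  proof -
    have "?D *v v = ?D *v (\<Sum>b\<in>B. (v \<bullet> b) *\<^sub>R b)"
      by (rule arg_cong[OF B(3)])
    also have "\<dots> = (\<Sum>b\<in>B. (v \<bullet> b) *\<^sub>R (?D *v b))"
      by (simp only: linear_sum[OF matrix_vector_mul_linear] linear_scale[OF matrix_vector_mul_linear])
    finally show ?thesis by (simp add: Db)
  qed
  then have "S *v v = T *v v" for v
    by (simp add: matrix_vector_mult_diff_rdistrib)
  then show ?thesis by (simp add: matrix_eq)
qed

lemma matrix_sqrt_eq_0_iff:
  fixes A :: "real ^ 'p ^ 'p"
  assumes A: "sym_pos_def A"
  shows "matrix_sqrt A *v x = 0 \<longleftrightarrow> x = 0"
proof -
  have "\<exists>!S. sym_pos_semidef S \<and> S ** S = A"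
    using sym_pos_def_sqrt_exists[OF A] by (rule ex_ex1I) (auto intro: sym_pos_def_sqrt_unique[OF A])
  then have sqrt: "matrix_sqrt A ** matrix_sqrt A = A"
    unfolding matrix_sqrt_def by (rule theI'[THEN conjunct2])
  have A_sqrt: "A *v x = matrix_sqrt A *v (matrix_sqrt A *v x)"
    unfolding matrix_vector_mul_assoc sqrt ..
  have "x = 0" if "matrix_sqrt A *v x = 0"
  proof (rule ccontr)
    assume "x \<noteq> 0"
    then have "x \<bullet> (A *v x) > 0" using A by (simp add: sym_pos_def_def)
    then show False unfolding A_sqrt that by simp
  qed
  then show ?thesis by auto
qed

section \<open>First-order optimality in penalised least squares\<close>

text \<open>Only \<open>g\<close> may fail to be differentiable. Comparing \<open>b\<close> with \<open>b + t (x - b)\<close>, convexity bounds the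
  growth of \<open>g\<close> by \<open>t (g x - g b)\<close>, while the loss decreases to first order by \<open>t\<close> times its negative
  gradient paired with \<open>x - b\<close>. Dividing by \<open>t\<close> and letting \<open>t\<close> tend to 0 gives the subgradient
  inequality, without any sum rule for subdifferentials.\<close>

lemma subgradient_at_penalised_least_squares_minimiser:
  fixes A :: "real ^ 'p ^ 'n" and g :: "real ^ 'p \<Rightarrow> real" and c :: real
  assumes c: "c > 0" and g: "convex_on UNIV g"
    and min: "is_arg_min (\<lambda>b. (norm (y - A *v b))\<^sup>2 / (2 * c) + g b) (\<lambda>b. True) b"
  shows "(transpose A *v (y - A *v b)) /\<^sub>R c \<in> subdifferential g b"
proof -
  define r where "r = y - A *v b"
  have "g b + (r \<bullet> (A *v (x - b))) / c \<le> g x" for x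
  proof -
    define w where "w = A *v (x - b)"
    have step: "(r \<bullet> w) / c - t * ((w \<bullet> w) / (2 * c)) \<le> g x - g b" if t: "0 < t" "t < 1" for t
    proof -
      have "g (b + t *\<^sub>R (x - b)) \<le> (1 - t) * g b + t * g x"
        using convex_onD[OF g, of t b x] t by (simp add: algebra_simps)
      moreover have "(norm r)\<^sup>2 / (2 * c) + g b
          \<le> (norm (y - A *v (b + t *\<^sub>R (x - b))))\<^sup>2 / (2 * c) + g (b + t *\<^sub>R (x - b))"
        using min unfolding is_arg_min_def r_def by (simp add: not_less)
      moreover have "y - A *v (b + t *\<^sub>R (x - b)) = r - t *\<^sub>R w"
        by (simp add: r_def w_def matrix_vector_right_distrib matrix_vector_mult_scaleR algebra_simps)
      moreover have "(norm (r - t *\<^sub>R w))\<^sup>2 / (2 * c)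
          = (norm r)\<^sup>2 / (2 * c) - t * ((r \<bullet> w) / c - t * ((w \<bullet> w) / (2 * c)))"
        using c by (simp add: power2_norm_eq_inner inner_diff_left inner_diff_right inner_commute field_simps)
      ultimately have "g b + t * ((r \<bullet> w) / c - t * ((w \<bullet> w) / (2 * c))) \<le> (1 - t) * g b + t * g x"
        by simp
      then have "t * ((r \<bullet> w) / c - t * ((w \<bullet> w) / (2 * c))) \<le> t * (g x - g b)"
        by (simp add: left_diff_distrib right_diff_distrib)
      then show ?thesis using t by simp
    qed
    have "((\<lambda>t. (r \<bullet> w) / c - t * ((w \<bullet> w) / (2 * c))) \<longlongrightarrow> (r \<bullet> w) / c - 0 * ((w \<bullet> w) / (2 * c))) (at_right 0)"
      by (intro tendsto_intros)
    moreover have "\<forall>\<^sub>F t in at_right 0. (r \<bullet> w) / c - t * ((w \<bullet> w) / (2 * c)) \<le> g x - g b"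
      unfolding eventually_at_right_field using step by (intro exI[of _ 1]) auto
    ultimately have "(r \<bullet> w) / c \<le> g x - g b"
      using tendsto_upperbound by fastforce
    then show ?thesis by (simp add: w_def)
  qed
  then show ?thesis
    by (simp add: subdifferential_def r_def dot_lmul_matrix divide_inverse mult.commute)
qed

section \<open>The energy inequality and its consequences\<close>

text \<open>Here \<open>z = X h\<close>, \<open>zs = X h\<^sup>*\<close> and \<open>e\<close> is the noise. Expanding \<open>\<parallel>z - e - zs\<parallel>\<^sup>2 \<ge> 0\<close> gives
  \<open>2 (z - zs) \<bullet> (e - z) \<le> \<parallel>e\<parallel>\<^sup>2 + \<parallel>zs\<parallel>\<^sup>2 - \<parallel>z\<parallel>\<^sup>2\<close>. This bound has the full \<open>\<parallel>z\<parallel>\<^sup>2\<close> on its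
  right side and no cross term between noise and signal, and this precision is needed for the
  constants in the final bounds.\<close>

lemma energy_inequality:
  fixes z zs e :: "'a::real_inner" and p q :: "'b::real_inner" and n B \<mu> :: real
  assumes n: "n > 0"
    and mono: "\<mu> * (norm (p - q))\<^sup>2 \<le> (z - zs) \<bullet> (e - z) / n + (p - q) \<bullet> q"
    and noise: "((norm e)\<^sup>2 + (norm zs)\<^sup>2) / n \<le> B + (norm q)\<^sup>2"
  shows "(norm z)\<^sup>2 / n + (1 + 2 * \<mu>) * (norm (p - q))\<^sup>2 \<le> B + (norm p)\<^sup>2"
proof -
  have "0 \<le> (norm (z - e - zs))\<^sup>2" by simp
  then have "2 * ((z - zs) \<bullet> (e - z)) \<le> (norm e)\<^sup>2 + (norm zs)\<^sup>2 - (norm z)\<^sup>2"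
    by (simp add: power2_norm_eq_inner algebra_simps inner_commute)
  then have "2 * ((z - zs) \<bullet> (e - z)) / n \<le> ((norm e)\<^sup>2 + (norm zs)\<^sup>2 - (norm z)\<^sup>2) / n"
    using n by (intro divide_right_mono) auto
  moreover have "2 * ((p - q) \<bullet> q) = (norm p)\<^sup>2 - (norm q)\<^sup>2 - (norm (p - q))\<^sup>2"
    by (simp add: power2_norm_eq_inner algebra_simps inner_commute)
  moreover have "(1 + 2 * \<mu>) * (norm (p - q))\<^sup>2 = (norm (p - q))\<^sup>2 + 2 * (\<mu> * (norm (p - q))\<^sup>2)"
    by (simp add: algebra_simps)
  ultimately show ?thesis
    using mono noise by (simp add: diff_divide_distrib)
qed

text \<open>In this lemma and the next, \<open>a\<close> and \<open>q\<close> stand for \<open>\<parallel>S h\<parallel>\<close> and \<open>\<parallel>S h\<^sup>*\<parallel>\<close>, and \<open>\<phi>\<close> for \<open>F / 2\<close>.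
  Inserting the energy inequality in \<open>a\<^sup>2 \<le> \<phi> t\<close> and completing the square around \<open>\<phi> q\<close> leaves
  \<open>(a - \<phi> q)\<^sup>2 \<le> \<phi> B + \<phi> (\<phi> - 1) q\<^sup>2 \<le> (\<phi> m)\<^sup>2\<close>.\<close>

lemma estimation_error_from_restricted_eigenvalue:
  fixes a q t B m \<phi> :: real
  assumes "q \<ge> 0" "m \<ge> 0" "B \<le> m\<^sup>2" "q \<le> m" "\<phi> \<ge> 1"
    and t: "t + (a - q)\<^sup>2 \<le> B + a\<^sup>2" and a: "a\<^sup>2 \<le> \<phi> * t"
  shows "a \<le> 2 * \<phi> * m"
proof -
  have "a\<^sup>2 \<le> \<phi> * (B + 2 * a * q - q\<^sup>2)"
    using a t assms(5) by (smt (verit, best) mult_left_mono power2_diff)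
  then have "(a - \<phi> * q)\<^sup>2 \<le> \<phi> * B + (\<phi> * (\<phi> - 1)) * q\<^sup>2"
    by (simp add: power2_eq_square algebra_simps)
  also have "\<dots> \<le> \<phi> * m\<^sup>2 + (\<phi> * (\<phi> - 1)) * m\<^sup>2"
    using assms by (intro add_mono mult_left_mono power_mono) auto
  also have "\<dots> = (\<phi> * m)\<^sup>2" by (simp add: power2_eq_square algebra_simps)
  finally have "(a - \<phi> * q)\<^sup>2 \<le> (\<phi> * m)\<^sup>2" .
  then have "a - \<phi> * q \<le> \<phi> * m"
    by (rule power2_le_imp_le) (use assms in simp)
  moreover have "\<phi> * q \<le> \<phi> * m" using assms by simp
  ultimately show ?thesis by simp
qed

text \<open>Replacing \<open>q\<close> and \<open>B\<close> by \<open>m\<close> and \<open>m\<^sup>2\<close> in the energy inequality, and multiplying by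
  \<open>\<phi> = 1 / \<mu>\<close>, gives \<open>a\<^sup>2 + m\<^sup>2 \<le> (\<phi> + 2) m a\<close>. Hence \<open>a \<le> (\<phi> + 2) m\<close>, and \<open>\<phi> + 2 \<le> 2 \<phi>\<close>
  because \<open>\<mu> \<le> 1/2\<close>.\<close>

lemma estimation_error_from_strong_monotonicity:
  fixes a q B m \<phi> \<mu> :: real
  assumes "m \<ge> 0" "B \<le> m\<^sup>2" "q \<le> m" and \<mu>: "0 < \<mu>" "\<mu> \<le> 1/2" "\<phi> = inverse \<mu>"
    and energy: "(1 + 2 * \<mu>) * (a - q)\<^sup>2 \<le> B + a\<^sup>2"
  shows "a \<le> 2 * \<phi> * m"
proof (rule ccontr)
  assume "\<not> a \<le> 2 * \<phi> * m"
  then have a: "a > 2 * \<phi> * m" by simp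
  have \<phi>: "\<phi> \<ge> 2" "\<mu> * \<phi> = 1"
    using \<mu> le_imp_inverse_le[of \<mu> "1/2"] by auto
  have cancel: "\<phi> * (\<mu> * x) = x" for x
    using \<phi>(2) by (metis mult.assoc mult.commute mult_1)
  have "2 * \<phi> * m \<ge> 4 * m" using \<phi> assms by (intro mult_right_mono) auto
  then have am: "a > m" using a assms by linarith
  have "(1 + 2 * \<mu>) * (a - m)\<^sup>2 \<le> (1 + 2 * \<mu>) * (a - q)\<^sup>2"
    using am assms by (intro mult_left_mono power_mono) auto
  then have "(1 + 2 * \<mu>) * (a - m)\<^sup>2 \<le> m\<^sup>2 + a\<^sup>2" using energy assms by linarith
  then have "\<mu> * (a\<^sup>2 + m\<^sup>2) \<le> (1 + 2 * \<mu>) * (a * m)"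
    by (simp add: power2_eq_square algebra_simps)
  then have "\<phi> * (\<mu> * (a\<^sup>2 + m\<^sup>2)) \<le> \<phi> * ((1 + 2 * \<mu>) * (a * m))"
    using \<phi> by (intro mult_left_mono) auto
  moreover have "\<phi> * (\<mu> * (a\<^sup>2 + m\<^sup>2)) = a\<^sup>2 + m\<^sup>2" by (rule cancel)
  moreover have "\<phi> * ((1 + 2 * \<mu>) * (a * m)) = (\<phi> + 2) * m * a"
    using cancel[of "a * m"] by (simp add: algebra_simps)
  moreover have "(\<phi> + 2) * m * a \<le> (2 * \<phi> * m) * a"
    using am assms \<phi> by (intro mult_right_mono) auto
  moreover have "(2 * \<phi> * m) * a < a * a"
    using a am assms by (intro mult_strict_right_mono) auto
  moreover have "m\<^sup>2 \<ge> 0" "a\<^sup>2 = a * a" by (simp_all add: power2_eq_square)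
  ultimately show False by linarith
qed

text \<open>The energy inequality bounds \<open>t\<close> by \<open>r\<^sup>2 + 2 a q - q\<^sup>2\<close>. If \<open>r \<le> q\<close>, then \<open>a \<le> F q\<close> and
  \<open>2 F - 1 \<le> F\<^sup>2\<close> give the second bound. If \<open>q < r\<close>, then \<open>a \<le> F r\<close>, and \<open>r\<^sup>2 + 2 F r q - q\<^sup>2\<close>
  increases in \<open>q\<close> up to \<open>q = r\<close>, where it equals the first bound.\<close>

lemma prediction_error_from_estimation_error:
  fixes a q r t F :: real
  assumes "q \<ge> 0" "r \<ge> 0" "F \<ge> 2" and a: "a \<le> F * max r q"
    and t: "t + (a - q)\<^sup>2 \<le> r\<^sup>2 + a\<^sup>2"
  shows "t \<le> max (2 * F * r\<^sup>2) (r\<^sup>2 + F\<^sup>2 * q\<^sup>2)"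
proof -
  have "2 * a * q \<le> 2 * (F * max r q) * q" using a assms by (intro mult_right_mono) auto
  then have t: "t \<le> r\<^sup>2 + 2 * F * max r q * q - q\<^sup>2"
    using t by (simp add: power2_eq_square algebra_simps)
  show ?thesis
  proof (cases "r \<le> q")
    case True
    have "0 \<le> (F - 1)\<^sup>2 * q\<^sup>2" by simp
    then show ?thesis using t True by (simp add: power2_eq_square algebra_simps)
  next
    case False
    have "0 \<le> (r - q) * (2 * F * r - r - q)"
    proof (rule mult_nonneg_nonneg)
      have "2 * 2 * r \<le> 2 * F * r" using assms by (intro mult_right_mono) auto
      then show "0 \<le> 2 * F * r - r - q" using False assms by linarith
    qed (use False in simp)
    then show ?thesis using t False by (simp add: power2_eq_square algebra_simps)
  qed
qed

theorem lemma5p2: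
  fixes X :: "real ^ 'p ^ 'n" and Sig :: "real ^ 'p ^ 'p"
    and \<beta> \<beta>hat \<beta>star h hstar :: "real ^ 'p" and \<epsilon> y :: "real ^ 'n"
    and g :: "real ^ 'p \<Rightarrow> real"
    and \<sigma> \<mu> n Rstar Fplus F sbar2 :: real
  assumes n: "n = real CARD('n)"
    and sigma: "\<sigma> > 0"
    and Sig: "sym_pos_def Sig"
    and y: "y = X *v \<beta> + \<epsilon>"
    and convex: "convex_on UNIV g"
    and bhat: "is_arg_min (\<lambda>b. (norm (y - X *v b))\<^sup>2 / (2 * n) + g b) (\<lambda>b. True) \<beta>hat"
    and h: "h = \<beta>hat - \<beta>"
    and bstar: "is_arg_min (\<lambda>b. (norm (matrix_sqrt Sig *v (\<beta> - b)))\<^sup>2 / 2 + g b) (\<lambda>b. True) \<beta>star"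
    and hstar: "hstar = \<beta>star - \<beta>"
    and Rstar: "Rstar = \<sigma>\<^sup>2 + (norm (matrix_sqrt Sig *v hstar))\<^sup>2"
    and mu: "\<mu> \<in> {0..1/2}"
    and penalty: "\<forall>u. \<forall>v \<in> subdifferential g (u + \<beta>star). \<forall>w \<in> subdifferential g \<beta>star.
        u \<bullet> (v - w) \<ge> \<mu> * (norm (matrix_sqrt Sig *v u))\<^sup>2"
    and Fplus: "Fplus = Max
        ((if hstar = 0 then {}
          else {(norm (X *v hstar))\<^sup>2 / (n * (norm (matrix_sqrt Sig *v hstar))\<^sup>2)})
         \<union> {(norm \<epsilon>)\<^sup>2 / (\<sigma>\<^sup>2 * n), (norm (\<epsilon> - X *v hstar))\<^sup>2 / (n * Rstar), 1})"
    and F_ge: "F / 2 \<ge> 1"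
    and F: "(norm (matrix_sqrt Sig *v h))\<^sup>2 \<le> (F / 2) * ((norm (X *v h))\<^sup>2 / n)
        \<or> (\<mu> > 0 \<and> F / 2 = inverse \<mu>)"
    and sbar2: "sbar2 = Fplus * \<sigma>\<^sup>2 + (Fplus - 1) * (norm (matrix_sqrt Sig *v hstar))\<^sup>2"
  shows "sbar2 = (Fplus - 1) * Rstar + \<sigma>\<^sup>2
    \<and> (norm (matrix_sqrt Sig *v h))\<^sup>2 \<le> F\<^sup>2 * max sbar2 ((norm (matrix_sqrt Sig *v hstar))\<^sup>2)
    \<and> F\<^sup>2 * max sbar2 ((norm (matrix_sqrt Sig *v hstar))\<^sup>2) \<le> Fplus * F\<^sup>2 * Rstar
    \<and> (norm (X *v h))\<^sup>2 / n
        \<le> max (2 * F * sbar2) (sbar2 + F\<^sup>2 * (norm (matrix_sqrt Sig *v hstar))\<^sup>2)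
    \<and> max (2 * F * sbar2) (sbar2 + F\<^sup>2 * (norm (matrix_sqrt Sig *v hstar))\<^sup>2)
        \<le> Fplus * F\<^sup>2 * Rstar"
proof -
  define S where "S = matrix_sqrt Sig"
  define p q where "p = S *v h" and "q = S *v hstar"
  define t where "t = (norm (X *v h))\<^sup>2 / n"
  have n0: "n > 0" using n by simp
  have mu0: "0 \<le> \<mu>" "\<mu> \<le> 1/2" using mu by auto

  have F1: "Fplus \<ge> 1" and Fe: "(norm \<epsilon>)\<^sup>2 / (\<sigma>\<^sup>2 * n) \<le> Fplus"
    unfolding Fplus by (rule Max_ge; simp)+
  have noise: "((norm \<epsilon>)\<^sup>2 + (norm (X *v hstar))\<^sup>2) / n \<le> sbar2 + (norm q)\<^sup>2"
  proof -
    have "(norm (X *v hstar))\<^sup>2 / n \<le> Fplus * (norm q)\<^sup>2"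
    proof (cases "hstar = 0")
      case True
      then show ?thesis using F1 by simp
    next
      case False
      then have "norm q > 0" by (simp add: q_def S_def matrix_sqrt_eq_0_iff[OF Sig])
      moreover have "(norm (X *v hstar))\<^sup>2 / (n * (norm q)\<^sup>2) \<le> Fplus"
        unfolding Fplus q_def S_def by (rule Max_ge) (use False in auto)
      ultimately show ?thesis using n0 by (simp add: field_simps)
    qed
    moreover have "(norm \<epsilon>)\<^sup>2 / n \<le> Fplus * \<sigma>\<^sup>2"
      using Fe n0 sigma by (simp add: field_simps)
    moreover have "sbar2 + (norm q)\<^sup>2 = Fplus * \<sigma>\<^sup>2 + Fplus * (norm q)\<^sup>2"
      by (simp add: sbar2 q_def S_def algebra_simps)
    ultimately show ?thesis by (simp add: add_divide_distrib)
  qed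

  \<comment> \<open>The penalty condition at the subgradients that the two minimisation problems provide.\<close>
  have mono: "\<mu> * (norm (p - q))\<^sup>2
      \<le> (X *v h - X *v hstar) \<bullet> (\<epsilon> - X *v h) / n + (p - q) \<bullet> q"
  proof -
    define u where "u = h - hstar"
    have u: "u + \<beta>star = \<beta>hat" by (simp add: u_def h hstar)
    have res: "y - X *v \<beta>hat = \<epsilon> - X *v h" "S *v \<beta> - S *v \<beta>star = - q"
      by (simp_all add: y h hstar q_def matrix_vector_mult_diff_distrib)
    have "(transpose X *v (\<epsilon> - X *v h)) /\<^sub>R n \<in> subdifferential g (u + \<beta>star)"
      using subgradient_at_penalised_least_squares_minimiser[OF n0 convex bhat]
      unfolding res u .
    moreover have "(transpose S *v (S *v \<beta> - S *v \<beta>star)) /\<^sub>R 1 \<in> subdifferential g \<beta>star"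
      by (rule subgradient_at_penalised_least_squares_minimiser[OF _ convex])
        (use bstar in \<open>simp_all add: S_def matrix_vector_mult_diff_distrib\<close>)
    then have "transpose S *v (- q) \<in> subdifferential g \<beta>star"
      unfolding res by simp
    ultimately have "\<mu> * (norm (S *v u))\<^sup>2
        \<le> u \<bullet> ((transpose X *v (\<epsilon> - X *v h)) /\<^sub>R n - transpose S *v (- q))"
      unfolding S_def by (rule penalty[rule_format])
    also have "\<dots> = (X *v u) \<bullet> (\<epsilon> - X *v h) / n + (S *v u) \<bullet> q"
      by (simp add: inner_diff_left inner_diff_right dot_lmul_matrix inner_commute[of u]
          inner_commute[of "_ *v u"] divide_inverse mult.commute)
    finally show ?thesis
      by (simp add: u_def p_def q_def matrix_vector_mult_diff_distrib)
  qed

  have "t + (1 + 2 * \<mu>) * (norm (p - q))\<^sup>2 \<le> sbar2 + (norm p)\<^sup>2"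
    unfolding t_def by (rule energy_inequality[OF n0 mono noise])
  moreover have "(1 + 2 * \<mu>) * (norm p - norm q)\<^sup>2 \<le> (1 + 2 * \<mu>) * (norm (p - q))\<^sup>2"
    using mu0 abs_le_square_iff[of "norm p - norm q" "norm (p - q)"] norm_triangle_ineq3[of p q]
    by (intro mult_left_mono) auto
  ultimately have energy: "t + (1 + 2 * \<mu>) * (norm p - norm q)\<^sup>2 \<le> sbar2 + (norm p)\<^sup>2"
    by linarith
  moreover have "(norm p - norm q)\<^sup>2 \<le> (1 + 2 * \<mu>) * (norm p - norm q)\<^sup>2"
    using mu0 by (simp add: mult_le_cancel_right1)
  ultimately have energy0: "t + (norm p - norm q)\<^sup>2 \<le> sbar2 + (norm p)\<^sup>2"
    by linarith

  have sb: "sbar2 = (Fplus - 1) * Rstar + \<sigma>\<^sup>2"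
    by (simp add: sbar2 Rstar algebra_simps)
  have R: "Rstar = \<sigma>\<^sup>2 + (norm q)\<^sup>2" by (simp add: Rstar q_def S_def)
  have sbR: "sbar2 + (norm q)\<^sup>2 = Fplus * Rstar" using sb R by (simp add: algebra_simps)
  have sb0: "sbar2 \<ge> 0" using F1 R by (simp add: sb)
  define r where "r = sqrt sbar2"
  have r: "r \<ge> 0" "r\<^sup>2 = sbar2" using sb0 by (simp_all add: r_def)
  define m where "m = max r (norm q)"
  have m: "m \<ge> 0" "norm q \<le> m" "sbar2 \<le> m\<^sup>2"
    using r by (auto simp: m_def simp flip: r(2) intro!: power_mono)
  have m2: "m\<^sup>2 = max sbar2 ((norm q)\<^sup>2)"
    using r by (simp add: m_def max_def flip: r(2))
  have "norm p \<le> 2 * (F / 2) * m"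
    using F
  proof
    assume "(norm (matrix_sqrt Sig *v h))\<^sup>2 \<le> (F / 2) * ((norm (X *v h))\<^sup>2 / n)"
    then show ?thesis
      using estimation_error_from_restricted_eigenvalue[OF _ m(1,3,2) F_ge energy0]
      by (simp add: p_def t_def S_def)
  next
    assume "\<mu> > 0 \<and> F / 2 = inverse \<mu>"
    moreover have "t \<ge> 0" using n0 by (simp add: t_def)
    ultimately show ?thesis
      using estimation_error_from_strong_monotonicity[OF m(1,3,2), of \<mu> "F / 2" "norm p"]
        mu0 energy by auto
  qed
  then have pm: "norm p \<le> F * m" by simp
  then have "(norm p)\<^sup>2 \<le> (F * m)\<^sup>2" by (intro power_mono) auto
  then have est: "(norm p)\<^sup>2 \<le> F\<^sup>2 * max sbar2 ((norm q)\<^sup>2)" by (simp add: m2 power_mult_distrib)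
  have pred: "t \<le> max (2 * F * sbar2) (sbar2 + F\<^sup>2 * (norm q)\<^sup>2)"
    using prediction_error_from_estimation_error[of "norm q" r F "norm p" t] r F_ge pm energy0
    by (simp add: m_def)
  have "max sbar2 ((norm q)\<^sup>2) \<le> sbar2 + (norm q)\<^sup>2" using sb0 by auto
  then have est_R: "F\<^sup>2 * max sbar2 ((norm q)\<^sup>2) \<le> F\<^sup>2 * (sbar2 + (norm q)\<^sup>2)"
    by (intro mult_left_mono) auto
  have "2 * F \<le> F\<^sup>2" using F_ge by (simp add: power2_eq_square)
  moreover have "1 \<le> F\<^sup>2" using F_ge by (intro one_le_power) simp
  ultimately have "2 * F * sbar2 \<le> F\<^sup>2 * sbar2" "1 * sbar2 \<le> F\<^sup>2 * sbar2"
    using sb0 by (intro mult_right_mono; simp)+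
  moreover have "0 \<le> F\<^sup>2 * (norm q)\<^sup>2" by simp
  ultimately have pred_R: "max (2 * F * sbar2) (sbar2 + F\<^sup>2 * (norm q)\<^sup>2) \<le> F\<^sup>2 * (sbar2 + (norm q)\<^sup>2)"
    unfolding distrib_left by (intro max.boundedI; linarith)
  have FR: "F\<^sup>2 * (sbar2 + (norm q)\<^sup>2) = Fplus * F\<^sup>2 * Rstar"
    unfolding sbR by (simp only: mult_ac)
  show ?thesis
    using sb est est_R[unfolded FR] pred pred_R[unfolded FR]
    unfolding p_def q_def S_def t_def by (intro conjI)
qed

end
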